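(* Let $K,M\subseteq\mathbb{R}$ be compact sets of positive Lebesgue measure, and let $\psi:[0,|M|]\to[0,|K|]$ be an increasing lipeomorphism. There exists an increasing lipeomorphism $\phi:M\to K$ satisfying $\pi_K\circ\phi=\psi\circ\pi_M$ if and only if $K$ and $M$ are gap $\psi$-compatible.
   Context: $\lambda$ denotes Lebesgue measure and $|K|=\lambda(K)$. A lipeomorphism is a bi-Lipschitz homeomorphism. For compact $K\subseteq\mathbb{R}$ of positive measure (likewise for $M$), the measure projection is $\pi_K:K\to[0,|K|]$, $\pi_K(x)=\lambda([\min K,x]\cap K)$, and $E_K=\{t\in[0,|K|]:\#\pi_K^{-1}(t)>1\}$. A gap of $K$ is an open interval $(\ell,r)\subseteq[\min K,\max K]$, $\ell<r$, with $\ell,r\in K$ and $(\ell,r)\cap K=\emptyset$; then $\pi_K(\ell)=\pi_K(r)$. Fiber $\psi$-compatibility: $K$ and $M$ are fiber $\psi$-compatible if $\psi(E_M)=E_K$ and for every $s\in E_M$ there exists an order-isomorphism (increasing bijection) $\pi_M^{-1}(s)\to\pi_K^{-1}(\psi(s))$. Corresponding gaps: if $K$ and $M$ are fiber $\psi$-compatible, $U=(\ell',r')$ is a gap of $M$, $s=\pi_M(\ell')=\pi_M(r')$ and $h:\pi_M^{-1}(s)\to\pi_K^{-1}(\psi(s))$ is an order-isomorphism, then $V_{U,h}:=(h(\ell'),h(r'))$ is a gap of $K$, called the gap corresponding to $U$ via $h$. Gap $\psi$-compatibility: $K$ and $M$ are gap $\psi$-compatible if they are fiber $\psi$-compatible and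 there exist order-isomorphisms $h_s:\pi_M^{-1}(s)\to\pi_K^{-1}(\psi(s))$ ($s\in E_M$) and a constant $C\ge1$ such that for every gap $U=(\ell',r')$ of $M$, with $s=\pi_M(\ell')=\pi_M(r')$, one has $C^{-1}\le\lambda(V_{U,h_s})/\lambda(U)\le C$. *)

theory Defs
  imports "HOL-Analysis.Analysis"
begin

definition lipeomorphism :: "real set \<Rightarrow> real set \<Rightarrow> (real \<Rightarrow> real) \<Rightarrow> bool" where
  "lipeomorphism A B f \<longleftrightarrow>
     (\<exists>g. homeomorphism A B f g \<and> (\<exists>L. L-lipschitz_on A f) \<and> (\<exists>L. L-lipschitz_on B g))"

definition increasing_lipeomorphism :: "real set \<Rightarrow> real set \<Rightarrow> (real \<Rightarrow> real) \<Rightarrow> bool" where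
  "increasing_lipeomorphism A B f \<longleftrightarrow> lipeomorphism A B f \<and> strict_mono_on A f"

definition order_isomorphism :: "real set \<Rightarrow> real set \<Rightarrow> (real \<Rightarrow> real) \<Rightarrow> bool" where
  "order_isomorphism A B h \<longleftrightarrow> bij_betw h A B \<and> strict_mono_on A h"

(* The sets K and M below are compact and nonempty, so Inf and Sup are min and max. *)
definition measure_projection :: "real set \<Rightarrow> real \<Rightarrow> real" where
  "measure_projection K x = measure lebesgue ({Inf K..x} \<inter> K)"

definition fiber :: "real set \<Rightarrow> real \<Rightarrow> real set" where
  "fiber K t = {x \<in> K. measure_projection K x = t}"

(* Fibers may be infinite, so "more than one element" is not expressed by card,
   which is 0 on infinite sets. *)
definition multiple_values :: "real set \<Rightarrow> real set" where
  "multiple_values K =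
     {t \<in> {0..measure lebesgue K}. \<exists>x\<in>fiber K t. \<exists>y\<in>fiber K t. x \<noteq> y}"

(* The gap is the open interval {l<..<r}, represented by its endpoints. *)
definition is_gap :: "real set \<Rightarrow> real \<Rightarrow> real \<Rightarrow> bool" where
  "is_gap K l r \<longleftrightarrow>
     l < r \<and> {l<..<r} \<subseteq> {Inf K..Sup K} \<and> l \<in> K \<and> r \<in> K \<and> {l<..<r} \<inter> K = {}"

definition fiber_compatible :: "(real \<Rightarrow> real) \<Rightarrow> real set \<Rightarrow> real set \<Rightarrow> bool" where
  "fiber_compatible \<psi> K M \<longleftrightarrow>
     \<psi> ` multiple_values M = multiple_values K \<and>
     (\<forall>s\<in>multiple_values M. \<exists>h. order_isomorphism (fiber M s) (fiber K (\<psi> s)) h)"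

definition corresponding_gap :: "(real \<Rightarrow> real) \<Rightarrow> real \<Rightarrow> real \<Rightarrow> real set" where
  "corresponding_gap h l r = {h l<..<h r}"

definition gap_compatible :: "(real \<Rightarrow> real) \<Rightarrow> real set \<Rightarrow> real set \<Rightarrow> bool" where
  "gap_compatible \<psi> K M \<longleftrightarrow>
     fiber_compatible \<psi> K M \<and>
     (\<exists>(h :: real \<Rightarrow> real \<Rightarrow> real) C.
        (\<forall>s\<in>multiple_values M. order_isomorphism (fiber M s) (fiber K (\<psi> s)) (h s)) \<and>
        1 \<le> C \<and>
        (\<forall>l r. is_gap M l r \<longrightarrow>
           (let s = measure_projection M l;
                q = measure lebesgue (corresponding_gap (h s) l r) / measure lebesgue {l<..<r}
            in inverse C \<le> q \<and> q \<le> C)))"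

end

theory Submission
  imports Defs
begin

text \<open>
  An increasing bijection \<open>\<phi>\<close> from \<open>M\<close> onto \<open>K\<close> with \<open>\<pi>\<^sub>K \<circ> \<phi> = \<psi> \<circ> \<pi>\<^sub>M\<close> is the same thing as a
  family of order isomorphisms between the fibers of \<open>\<pi>\<^sub>M\<close> over \<open>s\<close> and of \<open>\<pi>\<^sub>K\<close> over \<open>\<psi> s\<close>:
  it restricts to the fibers, and conversely such a family glues to an increasing map because
  \<open>\<psi>\<close> puts the fibers of \<open>K\<close> in the same order as those of \<open>M\<close>. Both
  projections are onto and \<open>\<psi>\<close> matches the multiple values of \<open>M\<close> with those of \<open>K\<close>, so over
  a value outside \<open>multiple_values M\<close> both fibers are singletons and there is nothing to choose.
  What remains is to see when the glued map is bi-Lipschitz.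

  For \<open>x \<le> y\<close> in \<open>M\<close>, the length of \<open>[x, y]\<close> splits into two parts
  (\<open>distance_eq_projection_plus_gaps\<close>): the measure of \<open>M\<close> inside, which is \<open>\<pi>\<^sub>M y - \<pi>\<^sub>M x\<close>,
  and the measure of the complement, which is the total length of the gaps of \<open>M\<close> inside.
  The map \<open>\<phi>\<close> distorts the first part exactly as \<open>\<psi>\<close> does, hence by a bounded factor. It sends
  the gaps of \<open>M\<close> in \<open>[x, y]\<close> onto the gaps of \<open>K\<close> in \<open>[\<phi> x, \<phi> y]\<close>, so by countable
  additivity a uniform bound on the distortion of single gaps bounds the distortion of the
  second part (\<open>complement_measure_le_of_gap_bound\<close>). Adding the two gives the Lipschitz bound
  (\<open>lipschitz_of_projection_and_gap_bounds\<close>), which is applied to \<open>\<phi>\<close> and to its inverse.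
  Conversely a bi-Lipschitz \<open>\<phi>\<close> distorts gaps by a bounded factor because their endpoints lie
  in \<open>M\<close>.
\<close>

section \<open>The measure projection\<close>

lemma lmeasurable_interval_compact:
  fixes K :: "real set"
  assumes "compact K"
  shows "{a..b} \<inter> K \<in> lmeasurable" "{a<..b} \<inter> K \<in> lmeasurable" "{a..b} - K \<in> lmeasurable"
proof -
  have K: "K \<in> sets lebesgue" using lmeasurable_compact[OF assms] by (rule fmeasurableD)
  have "{a<..b} \<in> lmeasurable"
    by (rule fmeasurableI2[of "{a..b}"]) auto
  then show "{a<..b} \<inter> K \<in> lmeasurable" using K by (rule fmeasurable_Int_fmeasurable)
  show "{a..b} \<inter> K \<in> lmeasurable" "{a..b} - K \<in> lmeasurable"
    using K by (auto intro: fmeasurable_Int_fmeasurable fmeasurable_Diff)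
qed

lemma measure_projection_diff:
  assumes "compact K" "x \<in> {Inf K..y}"
  shows "measure_projection K y - measure_projection K x = measure lebesgue ({x<..y} \<inter> K)"
proof -
  note meas = lmeasurable_interval_compact[OF assms(1)]
  have "{Inf K..y} \<inter> K = ({Inf K..x} \<inter> K) \<union> ({x<..y} \<inter> K)"
    using assms(2) by auto
  then have "measure lebesgue ({Inf K..y} \<inter> K) =
      measure lebesgue ({Inf K..x} \<inter> K) + measure lebesgue ({x<..y} \<inter> K)"
    by (simp only:, intro measure_Un_AE meas AE_I2) auto
  then show ?thesis by (simp add: measure_projection_def)
qed

lemma compact_bounds:
  fixes K :: "real set"
  assumes "compact K" "x \<in> K"
  shows "Inf K \<le> x" "x \<le> Sup K"
  using assms by (simp_all add: cInf_lower cSup_upper bounded_imp_bdd_below bounded_imp_bdd_above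
      compact_imp_bounded)

lemma measure_projection_mono:
  assumes "compact K" "x \<in> K" "x \<le> y"
  shows "measure_projection K x \<le> measure_projection K y"
  using measure_projection_diff[OF assms(1), of x y] compact_bounds[OF assms(1,2)] assms(3)
  by (smt (verit) atLeastAtMost_iff measure_nonneg)

lemma measure_projection_gap:
  assumes "compact K" "x \<in> K" "x \<le> y" "{x<..<y} \<inter> K = {}"
  shows "measure_projection K x = measure_projection K y"
proof -
  have "{x<..y} \<inter> K \<subseteq> {y}"
    using assms(4) by (force simp: less_le)
  then have "measure lebesgue ({x<..y} \<inter> K) \<le> measure lebesgue {y}"
    using lmeasurable_interval_compact(2)[OF assms(1)] lmeasurable_compact[of "{y}"]
    by (intro measure_mono_fmeasurable) (auto intro: fmeasurableD)
  then show ?thesis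
    using measure_projection_diff[OF assms(1), of x y] compact_bounds[OF assms(1,2)] assms(3)
      measure_nonneg[of lebesgue "{x<..y} \<inter> K"] by (simp del: measure_nonneg)
qed

lemma measure_projection_in_range:
  assumes "compact K"
  shows "measure_projection K x \<in> {0..measure lebesgue K}"
  using lmeasurable_interval_compact(1)[OF assms] lmeasurable_compact[OF assms]
  by (auto simp: measure_projection_def intro!: measure_mono_fmeasurable intro: fmeasurableD)

text \<open>
  On the convex hull of \<open>K\<close> the projection is continuous, so it takes the value \<open>t\<close>
  somewhere; since it is constant to the right of \<open>K\<close>-points until the next \<open>K\<close>-point, it
  takes it at the last point of \<open>K\<close> before that place.
\<close>
lemma fiber_nonempty:
  assumes "compact K" "K \<noteq> {}" "t \<in> {0..measure lebesgue K}"
  shows "fiber K t \<noteq> {}"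
proof -
  have ends: "Inf K \<in> K" "Sup K \<in> K"
    using assms closed_contains_Inf closed_contains_Sup compact_imp_closed
      bounded_imp_bdd_below bounded_imp_bdd_above compact_imp_bounded by metis+
  have "dist (measure_projection K x) (measure_projection K y) \<le> dist x y"
    if "x \<in> {Inf K..Sup K}" "y \<in> {Inf K..Sup K}" "x \<le> y" for x y
  proof -
    have "measure lebesgue ({x<..y} \<inter> K) \<le> measure lebesgue {x..y}"
      using lmeasurable_interval_compact(2)[OF assms(1)]
      by (intro measure_mono_fmeasurable) (auto intro: fmeasurableD)
    then show ?thesis
      using measure_projection_diff[OF assms(1), of x y] that measure_nonneg[of lebesgue "{x<..y} \<inter> K"]
      by (simp add: dist_real_def del: measure_nonneg)
  qed
  then have "1-lipschitz_on {Inf K..Sup K} (measure_projection K)"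
    by (intro lipschitz_onI) (auto, metis dist_commute linorder_linear)
  then have cont: "continuous_on {Inf K..Sup K} (measure_projection K)"
    by (rule lipschitz_on_continuous_on)
  have "measure_projection K (Inf K) \<le> t"
    using assms(3) measure_mono_fmeasurable[of "{Inf K..Inf K} \<inter> K" "{Inf K}" lebesgue] ends
    by (simp add: measure_projection_def)
  moreover have "{Inf K..Sup K} \<inter> K = K"
    using compact_bounds[OF assms(1)] by auto
  then have "t \<le> measure_projection K (Sup K)"
    using assms(3) by (simp add: measure_projection_def)
  ultimately obtain z where z: "Inf K \<le> z" "z \<le> Sup K" "measure_projection K z = t"
    using IVT'[of "measure_projection K" "Inf K" t "Sup K"] cont compact_bounds(1)[OF assms(1)] ends
    by auto
  define l where "l = Sup (K \<inter> {..z})"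
  have c: "compact (K \<inter> {..z})" and ne: "K \<inter> {..z} \<noteq> {}"
    using assms(1) z ends by (auto intro: compact_Int_closed)
  have l: "l \<in> K \<inter> {..z}"
    unfolding l_def using c ne closed_contains_Sup compact_imp_closed
      bounded_imp_bdd_above compact_imp_bounded by metis
  have "{l<..<z} \<inter> K = {}"
    using compact_bounds(2)[OF c] by (fastforce simp: l_def)
  then have "measure_projection K l = t"
    using measure_projection_gap[OF assms(1), of l z] l z by auto
  then show ?thesis using l by (auto simp: fiber_def)
qed

lemma distance_eq_projection_plus_gaps:
  assumes "compact K" "x \<in> K" "x \<le> y"
  shows "y - x = (measure_projection K y - measure_projection K x)
           + measure lebesgue ({x..y} - K)"
proof -
  note meas = lmeasurable_interval_compact(2,3)[OF assms(1)]
  (* The open left end costs nothing: x itself lies in K. *)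
  have "{x<..y} = ({x<..y} \<inter> K) \<union> ({x..y} - K)"
    using assms(2) by (auto simp: less_le)
  then have "measure lebesgue {x<..y} = measure lebesgue (({x<..y} \<inter> K) \<union> ({x..y} - K))"
    by (rule arg_cong)
  also have "\<dots> = measure lebesgue ({x<..y} \<inter> K) + measure lebesgue ({x..y} - K)"
    by (intro measure_Un_AE meas AE_I2) auto
  finally have "measure lebesgue {x<..y} =
      measure lebesgue ({x<..y} \<inter> K) + measure lebesgue ({x..y} - K)" .
  then show ?thesis
    using measure_projection_diff[OF assms(1), of x y] compact_bounds[OF assms(1,2)] assms(3)
    by simp
qed

section \<open>Gaps\<close>

lemma is_gap_iff:
  assumes "compact K"
  shows "is_gap K l r \<longleftrightarrow> l < r \<and> l \<in> K \<and> r \<in> K \<and> {l<..<r} \<inter> K = {}"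
  using compact_bounds[OF assms] unfolding is_gap_def
  by (auto, (meson order_trans less_imp_le)+)

lemma gap_around_point:
  assumes "compact K" "a \<in> K" "b \<in> K" "a \<le> z" "z \<le> b" "z \<notin> K"
  obtains l r where "is_gap K l r" "a \<le> l" "l < z" "z < r" "r \<le> b"
proof -
  define l where "l = Sup (K \<inter> {..z})"
  define r where "r = Inf (K \<inter> {z..})"
  have c: "compact (K \<inter> {..z})" "compact (K \<inter> {z..})"
    using assms(1) by (auto intro: compact_Int_closed)
  have ne: "K \<inter> {..z} \<noteq> {}" "K \<inter> {z..} \<noteq> {}"
    using assms by auto
  have l: "l \<in> K \<inter> {..z}"
    unfolding l_def using c ne closed_contains_Sup compact_imp_closed
      bounded_imp_bdd_above compact_imp_bounded by metis
  have r: "r \<in> K \<inter> {z..}"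
    unfolding r_def using c ne closed_contains_Inf compact_imp_closed
      bounded_imp_bdd_below compact_imp_bounded by metis
  have l': "u \<le> l" if "u \<in> K" "u \<le> z" for u
    using compact_bounds(2)[OF c(1)] that by (auto simp: l_def)
  have r': "r \<le> u" if "u \<in> K" "z \<le> u" for u
    using compact_bounds(1)[OF c(2)] that by (auto simp: r_def)
  have "l < z" "z < r"
    using l r assms(6) by (auto simp: less_le)
  moreover have "{l<..<r} \<inter> K = {}"
    using l' r' by force
  ultimately show thesis
    using that[of l r] l r l' r' assms by (auto simp: is_gap_iff)
qed

text \<open>
  If two overlapping gaps had different left endpoints, the larger of these would lie inside
  the other gap, although endpoints belong to \<open>K\<close>; likewise on the right.
\<close>
lemma gap_disjoint:
  assumes "is_gap K l r" "is_gap K l' r'" "{l<..<r} \<inter> {l'<..<r'} \<noteq> {}"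
  shows "l = l'" "r = r'"
proof -
  obtain z where z: "l < z" "z < r" "l' < z" "z < r'"
    using assms(3) unfolding disjoint_iff greaterThanLessThan_iff by blast
  have out: "u \<notin> {l<..<r}" "u \<notin> {l'<..<r'}" if "u \<in> K" for u
    using assms(1,2) that by (auto simp: is_gap_def)
  have "l \<in> K" "r \<in> K" "l' \<in> K" "r' \<in> K" using assms(1,2) by (auto simp: is_gap_def)
  then show "l = l'" "r = r'"
    using out[of l] out[of l'] out[of r] out[of r'] z by auto
qed

lemma countable_gaps: "countable {(l, r). is_gap K l r}"
proof -
  have "inj_on (\<lambda>(l, r). {l<..<r}) {(l, r). is_gap K l r}"
  proof (rule inj_onI, clarify)
    fix l r l' r' assume g: "is_gap K l r" "is_gap K l' r'" and eq: "{l<..<r} = {l'<..<r'}"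
    have "{l<..<r} \<noteq> {}" using g(1) by (simp add: is_gap_def)
    then show "l = l' \<and> r = r'" using gap_disjoint[OF g] eq by blast
  qed
  moreover have "countable ((\<lambda>(l, r). {l<..<r}) ` {(l, r). is_gap K l r})"
  proof (rule countable_disjoint_open_subsets)
    show "pairwise disjnt ((\<lambda>(l, r). {l<..<r}) ` {(l, r). is_gap K l r})"
      unfolding pairwise_image pairwise_def disjnt_def using gap_disjoint by fast
  qed auto
  ultimately show ?thesis by (rule countable_image_inj_on[rotated])
qed

lemma order_isomorphism_less_iff:
  assumes "order_isomorphism M K \<phi>" "x \<in> M" "y \<in> M"
  shows "\<phi> x < \<phi> y \<longleftrightarrow> x < y"
  using assms strict_mono_on_less unfolding order_isomorphism_def by metis

lemma order_isomorphism_inverse: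
  assumes "order_isomorphism M K \<phi>"
  shows "order_isomorphism K M (inv_into M \<phi>)"
proof -
  have bij: "bij_betw \<phi> M K" using assms by (simp add: order_isomorphism_def)
  have inv: "inv_into M \<phi> z \<in> M" "\<phi> (inv_into M \<phi> z) = z" if "z \<in> K" for z
    using bij that by (auto simp: bij_betw_def inv_into_into f_inv_into_f)
  have "inv_into M \<phi> y < inv_into M \<phi> z" if "y \<in> K" "z \<in> K" "y < z" for y z
    using order_isomorphism_less_iff[OF assms inv(1)[OF that(1)] inv(1)[OF that(2)]] inv(2) that
    by simp
  then have "strict_mono_on K (inv_into M \<phi>)" by (intro strict_mono_onI)
  then show ?thesis using bij_betw_inv_into[OF bij] by (simp add: order_isomorphism_def)
qed

lemma order_isomorphism_is_gap_iff:
  assumes "compact M" "compact K" "order_isomorphism M K \<phi>" "l \<in> M" "r \<in> M"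
  shows "is_gap K (\<phi> l) (\<phi> r) \<longleftrightarrow> is_gap M l r"
proof -
  have K: "K = \<phi> ` M"
    using assms(3) by (auto simp: order_isomorphism_def bij_betw_def)
  have "{\<phi> l<..<\<phi> r} \<inter> \<phi> ` M = {} \<longleftrightarrow> {l<..<r} \<inter> M = {}"
    using order_isomorphism_less_iff[OF assms(3)] assms(4,5)
    unfolding disjoint_iff greaterThanLessThan_iff by blast
  then show ?thesis
    using order_isomorphism_less_iff[OF assms(3-5)] assms K by (auto simp: is_gap_iff)
qed

section \<open>From bounds on single gaps to a Lipschitz bound\<close>

text \<open>
  Both complements are countable unions of gaps, and both are indexed here by the gaps of
  \<open>M\<close>: every gap of \<open>K\<close> is the image of one of \<open>M\<close>. The gap bound can then be summed
  term by term.
\<close>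
lemma complement_measure_le_of_gap_bound:
  assumes M: "compact M" and K: "compact K" and iso: "order_isomorphism M K \<phi>"
    and C: "0 \<le> C" and gap: "\<And>l r. is_gap M l r \<Longrightarrow> \<phi> r - \<phi> l \<le> C * (r - l)"
    and x: "x \<in> M" and y: "y \<in> M"
  shows "measure lebesgue ({\<phi> x..\<phi> y} - K) \<le> C * measure lebesgue ({x..y} - M)"
proof -
  define G where "G = {(l, r). is_gap M l r \<and> x \<le> l \<and> r \<le> y}"
  have le: "\<phi> a \<le> \<phi> b \<longleftrightarrow> a \<le> b" if "a \<in> M" "b \<in> M" for a b
    using order_isomorphism_less_iff[OF iso that(2,1)] by (simp flip: not_less)
  have img: "\<phi> ` M = K"
    using iso by (simp add: order_isomorphism_def bij_betw_def)
  have cG: "countable G"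
    by (rule countable_subset[OF _ countable_gaps[of M]]) (auto simp: G_def)
  have coverM: "(\<Union>(l, r)\<in>G. {l<..<r}) = {x..y} - M"
  proof
    show "(\<Union>(l, r)\<in>G. {l<..<r}) \<subseteq> {x..y} - M"
      by (auto simp: G_def is_gap_def disjoint_iff)
    show "{x..y} - M \<subseteq> (\<Union>(l, r)\<in>G. {l<..<r})"
    proof
      fix z assume "z \<in> {x..y} - M"
      then obtain l r where "is_gap M l r" "x \<le> l" "l < z" "z < r" "r \<le> y"
        using gap_around_point[OF M x y, of z] by auto
      then show "z \<in> (\<Union>(l, r)\<in>G. {l<..<r})" by (force simp: G_def)
    qed
  qed
  have coverK: "{\<phi> x..\<phi> y} - K \<subseteq> (\<Union>(l, r)\<in>G. {\<phi> l<..<\<phi> r})"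
  proof
    fix z assume "z \<in> {\<phi> x..\<phi> y} - K"
    moreover have "\<phi> x \<in> K" "\<phi> y \<in> K" using x y img by auto
    ultimately obtain l' r' where
      g: "is_gap K l' r'" "\<phi> x \<le> l'" "l' < z" "z < r'" "r' \<le> \<phi> y"
      using gap_around_point[OF K, of "\<phi> x" "\<phi> y" z] by auto
    obtain l r where lr: "l \<in> M" "r \<in> M" "l' = \<phi> l" "r' = \<phi> r"
      using g(1) img by (auto simp: is_gap_def)
    have "(l, r) \<in> G"
      using g lr le[OF x lr(1)] le[OF lr(2) y]
        order_isomorphism_is_gap_iff[OF M K iso lr(1,2)] by (auto simp: G_def)
    then show "z \<in> (\<Union>(l, r)\<in>G. {\<phi> l<..<\<phi> r})" using g lr by force
  qed
  have disj: "disjoint_family_on (\<lambda>p. {fst p<..<snd p}) G"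
    unfolding disjoint_family_on_def
  proof (intro ballI impI, rule ccontr)
    fix p q assume pq: "p \<in> G" "q \<in> G" "p \<noteq> q"
      and ne: "{fst p<..<snd p} \<inter> {fst q<..<snd q} \<noteq> {}"
    have "is_gap M (fst p) (snd p)" "is_gap M (fst q) (snd q)"
      using pq by (auto simp: G_def)
    from gap_disjoint[OF this ne] show False using pq(3) by (simp add: prod_eq_iff)
  qed
  have disj': "disjoint_family_on (\<lambda>p. {\<phi> (fst p)<..<\<phi> (snd p)}) G"
    unfolding disjoint_family_on_def
  proof (intro ballI impI, rule ccontr)
    fix p q assume pq: "p \<in> G" "q \<in> G" "p \<noteq> q"
      and ne: "{\<phi> (fst p)<..<\<phi> (snd p)} \<inter> {\<phi> (fst q)<..<\<phi> (snd q)} \<noteq> {}"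
    have in_M: "fst p \<in> M" "snd p \<in> M" "fst q \<in> M" "snd q \<in> M"
      using pq by (auto simp: G_def is_gap_def)
    have "is_gap K (\<phi> (fst p)) (\<phi> (snd p))" "is_gap K (\<phi> (fst q)) (\<phi> (snd q))"
      using pq in_M order_isomorphism_is_gap_iff[OF M K iso] by (auto simp: G_def)
    from gap_disjoint[OF this ne] have "fst p = fst q \<and> snd p = snd q"
      using in_M le by (metis order_antisym order_refl)
    then show False using pq(3) by (simp add: prod_eq_iff)
  qed
  have "emeasure lebesgue ({\<phi> x..\<phi> y} - K)
      \<le> emeasure lebesgue (\<Union>p\<in>G. {\<phi> (fst p)<..<\<phi> (snd p)})"
    using coverK cG by (intro emeasure_mono) (auto simp: case_prod_beta)
  also have "\<dots> = (\<integral>\<^sup>+p. emeasure lebesgue {\<phi> (fst p)<..<\<phi> (snd p)} \<partial>count_space G)"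
    using cG disj' by (intro emeasure_UN_countable) auto
  also have "\<dots> \<le> (\<integral>\<^sup>+p. ennreal C * emeasure lebesgue {fst p<..<snd p} \<partial>count_space G)"
  proof (intro nn_integral_mono)
    fix p assume "p \<in> space (count_space G)"
    then have g: "is_gap M (fst p) (snd p)" by (auto simp: G_def)
    then have "\<phi> (fst p) < \<phi> (snd p)"
      using order_isomorphism_less_iff[OF iso] by (auto simp: is_gap_def)
    then show "emeasure lebesgue {\<phi> (fst p)<..<\<phi> (snd p)}
        \<le> ennreal C * emeasure lebesgue {fst p<..<snd p}"
      using gap[OF g] g C by (simp add: is_gap_def ennreal_leI flip: ennreal_mult)
  qed
  also have "\<dots> = ennreal C * (\<integral>\<^sup>+p. emeasure lebesgue {fst p<..<snd p} \<partial>count_space G)"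
    by (simp add: nn_integral_cmult)
  also have "(\<integral>\<^sup>+p. emeasure lebesgue {fst p<..<snd p} \<partial>count_space G)
      = emeasure lebesgue (\<Union>p\<in>G. {fst p<..<snd p})"
    using cG disj by (intro emeasure_UN_countable[symmetric]) auto
  also have "(\<Union>p\<in>G. {fst p<..<snd p}) = {x..y} - M"
    using coverM by (simp add: case_prod_beta)
  finally have "emeasure lebesgue ({\<phi> x..\<phi> y} - K)
      \<le> ennreal C * emeasure lebesgue ({x..y} - M)" .
  moreover note lmeasurable_interval_compact(3)[OF M] lmeasurable_interval_compact(3)[OF K]
  ultimately show ?thesis
    using C by (simp add: emeasure_eq_measure2 flip: ennreal_mult)
qed

text \<open>
  The projection bound controls the part of a distance that is spent inside the set, and the
  gap bound controls the part spent in the complement. Both bounds are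
  one-sided, so that the same statement, for the inverses of \<open>\<phi>\<close> and \<open>\<psi>\<close>, gives the Lipschitz
  bound in the other direction.
\<close>
lemma lipschitz_of_projection_and_gap_bounds:
  assumes M: "compact M" and K: "compact K" and iso: "order_isomorphism M K \<phi>"
    and L: "L-lipschitz_on {0..measure lebesgue M} \<psi>"
    and proj: "\<And>x. x \<in> M \<Longrightarrow> measure_projection K (\<phi> x) = \<psi> (measure_projection M x)"
    and C: "0 \<le> C" and gap: "\<And>l r. is_gap M l r \<Longrightarrow> \<phi> r - \<phi> l \<le> C * (r - l)"
  shows "(max L C)-lipschitz_on M \<phi>"
proof -
  have bound: "dist (\<phi> x) (\<phi> y) \<le> max L C * dist x y" if xy: "x \<in> M" "y \<in> M" "x \<le> y" for x y
  proof -
    let ?p = "measure_projection M" and ?q = "measure_projection K"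
    have \<phi>xy: "\<phi> x \<in> K" "\<phi> y \<in> K" "\<phi> x \<le> \<phi> y"
      using iso xy order_isomorphism_less_iff[OF iso xy(2,1)]
      by (auto simp: order_isomorphism_def bij_betw_def)
    have "dist (\<psi> (?p x)) (\<psi> (?p y)) \<le> L * dist (?p x) (?p y)"
      using lipschitz_onD[OF L] measure_projection_in_range[OF M] by blast
    then have "?q (\<phi> y) - ?q (\<phi> x) \<le> L * (?p y - ?p x)"
      using measure_projection_mono[OF M xy(1,3)] by (simp add: proj xy dist_real_def abs_if split: if_splits)
    also have "\<dots> \<le> max L C * (?p y - ?p x)"
      using measure_projection_mono[OF M xy(1,3)] by (intro mult_right_mono) auto
    finally have 1: "?q (\<phi> y) - ?q (\<phi> x) \<le> max L C * (?p y - ?p x)" .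
    have "measure lebesgue ({\<phi> x..\<phi> y} - K) \<le> C * measure lebesgue ({x..y} - M)"
      by (rule complement_measure_le_of_gap_bound[OF M K iso C gap xy(1,2)])
    also have "\<dots> \<le> max L C * measure lebesgue ({x..y} - M)"
      by (intro mult_right_mono) auto
    finally have "\<phi> y - \<phi> x \<le> max L C * (y - x)"
      using 1 distance_eq_projection_plus_gaps[OF M xy(1,3)]
        distance_eq_projection_plus_gaps[OF K \<phi>xy(1,3)] by (simp add: distrib_left)
    then show ?thesis using xy \<phi>xy by (simp add: dist_real_def)
  qed
  show ?thesis
  proof (rule lipschitz_onI)
    show "dist (\<phi> x) (\<phi> y) \<le> max L C * dist x y" if "x \<in> M" "y \<in> M" for x y
      using bound[of x y] bound[of y x] that by (cases "x \<le> y") (auto simp: dist_commute)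
  qed (use C in simp)
qed

section \<open>Gluing order isomorphisms of fibers\<close>

text \<open>
  Since the projections are monotone, points with different projections are ordered as their
  projections are, and \<open>\<psi>\<close> preserves that order; within a fiber the order is preserved by \<open>h s\<close>.
\<close>
lemma order_isomorphism_glue:
  assumes M: "compact M" and K: "compact K"
    and \<psi>: "order_isomorphism {0..measure lebesgue M} {0..measure lebesgue K} \<psi>"
    and h: "\<And>s. s \<in> {0..measure lebesgue M} \<Longrightarrow>
          order_isomorphism (fiber M s) (fiber K (\<psi> s)) (h s)"
  defines "\<phi> \<equiv> \<lambda>x. h (measure_projection M x) x"
  shows "order_isomorphism M K \<phi>"
    and "x \<in> M \<Longrightarrow> measure_projection K (\<phi> x) = \<psi> (measure_projection M x)"
proof -
  let ?p = "measure_projection M" and ?q = "measure_projection K"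
  have fib: "\<phi> u \<in> K" "?q (\<phi> u) = \<psi> (?p u)" if "u \<in> M" for u
  proof -
    have "bij_betw (h (?p u)) (fiber M (?p u)) (fiber K (\<psi> (?p u)))"
      using h[OF measure_projection_in_range[OF M, of u]] by (simp add: order_isomorphism_def)
    moreover have "u \<in> fiber M (?p u)" using that by (simp add: fiber_def)
    ultimately have "\<phi> u \<in> fiber K (\<psi> (?p u))" unfolding \<phi>_def by (rule bij_betwE[THEN bspec])
    then show "\<phi> u \<in> K" "?q (\<phi> u) = \<psi> (?p u)" by (simp_all add: fiber_def)
  qed
  show "?q (\<phi> x) = \<psi> (?p x)" if "x \<in> M"
    using fib(2)[OF that] .
  have "strict_mono_on M \<phi>"
  proof (rule strict_mono_onI)
    fix x y assume xy: "x \<in> M" "y \<in> M" "x < y"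
    consider "?p x = ?p y" | "?p x < ?p y"
      using measure_projection_mono[OF M xy(1), of y] xy(3) by linarith
    then show "\<phi> x < \<phi> y"
    proof cases
      case 1
      then have "x \<in> fiber M (?p y)" "y \<in> fiber M (?p y)" using xy by (auto simp: fiber_def)
      from order_isomorphism_less_iff[OF h[OF measure_projection_in_range[OF M]] this]
      show ?thesis using xy(3) 1 by (simp add: \<phi>_def)
    next
      case 2
      then have "\<psi> (?p x) < \<psi> (?p y)"
        using order_isomorphism_less_iff[OF \<psi> measure_projection_in_range[OF M]
            measure_projection_in_range[OF M]] by simp
      then have "?q (\<phi> x) < ?q (\<phi> y)"
        using fib(2) xy by simp
      then show ?thesis
        using measure_projection_mono[OF K fib(1)[OF xy(2)], of "\<phi> x"] by linarith
    qed
  qed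
  moreover have "\<phi> ` M = K"
  proof
    show "\<phi> ` M \<subseteq> K" using fib(1) by blast
    show "K \<subseteq> \<phi> ` M"
    proof
      fix z assume z: "z \<in> K"
      obtain s where s: "s \<in> {0..measure lebesgue M}" "\<psi> s = ?q z"
        using \<psi> measure_projection_in_range[OF K, of z]
        unfolding order_isomorphism_def bij_betw_def by (metis imageE)
      have "h s ` fiber M s = fiber K (\<psi> s)"
        using h[OF s(1)] by (simp add: order_isomorphism_def bij_betw_def)
      moreover have "z \<in> fiber K (\<psi> s)" using z s(2) by (simp add: fiber_def)
      ultimately obtain u where "u \<in> fiber M s" "z = h s u" by blast
      then have "u \<in> M" "z = \<phi> u" by (auto simp: fiber_def \<phi>_def)
      then show "z \<in> \<phi> ` M" by blast
    qed
  qed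
  ultimately show "order_isomorphism M K \<phi>"
    by (simp add: order_isomorphism_def bij_betw_def strict_mono_on_imp_inj_on)
qed

lemma order_isomorphism_restrict_fiber:
  assumes M: "compact M" and iso: "order_isomorphism M K \<phi>"
    and \<psi>: "inj_on \<psi> {0..measure lebesgue M}"
    and proj: "\<And>x. x \<in> M \<Longrightarrow> measure_projection K (\<phi> x) = \<psi> (measure_projection M x)"
    and s: "s \<in> {0..measure lebesgue M}"
  shows "order_isomorphism (fiber M s) (fiber K (\<psi> s)) \<phi>"
proof -
  have img: "\<phi> ` M = K" using iso by (simp add: order_isomorphism_def bij_betw_def)
  have "\<phi> ` fiber M s = fiber K (\<psi> s)"
  proof
    show "\<phi> ` fiber M s \<subseteq> fiber K (\<psi> s)"
    proof
      fix z assume "z \<in> \<phi> ` fiber M s"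
      then obtain x where x: "x \<in> M" "measure_projection M x = s" "z = \<phi> x"
        by (auto simp: fiber_def)
      then have "z \<in> K" using img by blast
      then show "z \<in> fiber K (\<psi> s)" using proj[OF x(1)] x by (simp add: fiber_def)
    qed
    show "fiber K (\<psi> s) \<subseteq> \<phi> ` fiber M s"
    proof
      fix z assume "z \<in> fiber K (\<psi> s)"
      then have "z \<in> K" and z: "measure_projection K z = \<psi> s" by (simp_all add: fiber_def)
      then obtain x where x: "x \<in> M" "z = \<phi> x" using img by blast
      have "\<psi> (measure_projection M x) = \<psi> s" using proj[OF x(1)] z x(2) by simp
      then have "measure_projection M x = s"
        by (rule inj_onD[OF \<psi> _ measure_projection_in_range[OF M] s])
      then show "z \<in> \<phi> ` fiber M s" using x by (auto simp: fiber_def)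
    qed
  qed
  moreover have "fiber M s \<subseteq> M" by (auto simp: fiber_def)
  then have "strict_mono_on (fiber M s) \<phi>"
    using iso by (auto simp: order_isomorphism_def intro: monotone_on_subset)
  ultimately show ?thesis
    by (simp add: order_isomorphism_def bij_betw_def strict_mono_on_imp_inj_on)
qed

lemma multiple_values_image:
  assumes \<psi>: "bij_betw \<psi> {0..measure lebesgue M} {0..measure lebesgue K}"
    and h: "\<And>s. s \<in> {0..measure lebesgue M} \<Longrightarrow> bij_betw (h s) (fiber M s) (fiber K (\<psi> s))"
  shows "\<psi> ` multiple_values M = multiple_values K"
proof -
  have iff: "(\<exists>x\<in>fiber M s. \<exists>y\<in>fiber M s. x \<noteq> y) \<longleftrightarrow>
      (\<exists>x\<in>fiber K (\<psi> s). \<exists>y\<in>fiber K (\<psi> s). x \<noteq> y)" if "s \<in> {0..measure lebesgue M}" for s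
  proof -
    have img: "fiber K (\<psi> s) = h s ` fiber M s" and inj: "inj_on (h s) (fiber M s)"
      using h[OF that] by (simp_all add: bij_betw_def)
    show ?thesis
      unfolding img using inj_on_eq_iff[OF inj] by (simp cong: bex_cong)
  qed
  have img: "{0..measure lebesgue K} = \<psi> ` {0..measure lebesgue M}"
    using \<psi> by (simp add: bij_betw_def)
  have "s \<in> multiple_values M \<longleftrightarrow> \<psi> s \<in> multiple_values K" if "s \<in> {0..measure lebesgue M}" for s
    unfolding multiple_values_def mem_Collect_eq img using iff[OF that] that by simp
  moreover have "multiple_values M \<subseteq> {0..measure lebesgue M}"
      "multiple_values K \<subseteq> \<psi> ` {0..measure lebesgue M}"
    unfolding img[symmetric] by (auto simp: multiple_values_def)
  ultimately show ?thesis by fast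
qed

text \<open>
  The measure projection is onto, so outside the multiple values the fibers on both sides are
  singletons rather than empty; the given family of order isomorphisms therefore extends to
  all values, in the only possible way.
\<close>
lemma extend_fiber_isomorphisms:
  assumes "compact M" "M \<noteq> {}" "compact K" "K \<noteq> {}"
    and \<psi>: "bij_betw \<psi> {0..measure lebesgue M} {0..measure lebesgue K}"
    and mv: "\<psi> ` multiple_values M = multiple_values K"
    and h: "\<And>s. s \<in> multiple_values M \<Longrightarrow> order_isomorphism (fiber M s) (fiber K (\<psi> s)) (h s)"
  obtains h' where
    "\<And>s. s \<in> {0..measure lebesgue M} \<Longrightarrow> order_isomorphism (fiber M s) (fiber K (\<psi> s)) (h' s)"
    "\<And>s. s \<in> multiple_values M \<Longrightarrow> h' s = h s"
proof -
  have "\<exists>f. order_isomorphism (fiber M s) (fiber K (\<psi> s)) f \<and> (s \<in> multiple_values M \<longrightarrow> f = h s)"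
    if s: "s \<in> {0..measure lebesgue M}" for s
  proof (cases "s \<in> multiple_values M")
    case True
    then show ?thesis using h by blast
  next
    case False
    have \<psi>s: "\<psi> s \<in> {0..measure lebesgue K}" using \<psi> s by (auto simp: bij_betw_def)
    have "\<psi> s \<notin> multiple_values K"
    proof
      assume "\<psi> s \<in> multiple_values K"
      then obtain s' where s': "s' \<in> multiple_values M" "\<psi> s' = \<psi> s" using mv by (metis imageE)
      then have "s' = s"
        using \<psi> s inj_onD[of \<psi> "{0..measure lebesgue M}" s' s]
        by (auto simp: bij_betw_def multiple_values_def)
      then show False using s' False by simp
    qed
    then have unique: "\<forall>x\<in>fiber M s. \<forall>y\<in>fiber M s. x = y"
        "\<forall>x\<in>fiber K (\<psi> s). \<forall>y\<in>fiber K (\<psi> s). x = y"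
      using False s \<psi>s by (simp_all add: multiple_values_def)
    obtain a b where "a \<in> fiber M s" "b \<in> fiber K (\<psi> s)"
      using fiber_nonempty[OF assms(1,2) s] fiber_nonempty[OF assms(3,4) \<psi>s] by blast
    then have "fiber M s = {a}" "fiber K (\<psi> s) = {b}"
      using unique by blast+
    then have "order_isomorphism (fiber M s) (fiber K (\<psi> s)) (\<lambda>_. b)"
      by (auto simp: order_isomorphism_def bij_betw_def strict_mono_on_def)
    then show ?thesis using False by blast
  qed
  then have "\<forall>s\<in>{0..measure lebesgue M}. \<exists>f. order_isomorphism (fiber M s) (fiber K (\<psi> s)) f
      \<and> (s \<in> multiple_values M \<longrightarrow> f = h s)" by blast
  from bchoice[OF this] obtain h' where "\<forall>s\<in>{0..measure lebesgue M}.
      order_isomorphism (fiber M s) (fiber K (\<psi> s)) (h' s) \<and> (s \<in> multiple_values M \<longrightarrow> h' s = h s)"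
    by blast
  then show thesis using that[of h'] by (auto simp: multiple_values_def)
qed

section \<open>The characterization\<close>

text \<open>
  Lipschitz maps are continuous, so the topological part of the notion is automatic once the
  inverse is pinned down as \<open>inv_into A f\<close>.
\<close>
lemma lipeomorphism_iff_bij_lipschitz:
  "lipeomorphism A B f \<longleftrightarrow>
     bij_betw f A B \<and> (\<exists>L. L-lipschitz_on A f) \<and> (\<exists>L. L-lipschitz_on B (inv_into A f))"
proof
  assume "lipeomorphism A B f"
  then obtain g L L' where g: "homeomorphism A B f g" "L-lipschitz_on A f" "L'-lipschitz_on B g"
    by (auto simp: lipeomorphism_def)
  then have "f ` A = B" "\<forall>x\<in>A. g (f x) = x" by (simp_all add: homeomorphism_def)
  then have bij: "bij_betw f A B" by (auto simp: bij_betw_def intro: inj_on_inverseI)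
  have "inv_into A f y = g y" if "y \<in> B" for y
  proof (rule inv_into_f_eq)
    show "inj_on f A" using bij by (simp add: bij_betw_def)
    show "g y \<in> A" "f (g y) = y" using g(1) that by (auto simp: homeomorphism_def)
  qed
  then have "L'-lipschitz_on B (inv_into A f)"
    using g(3) by (simp add: lipschitz_on_def)
  then show "bij_betw f A B \<and> (\<exists>L. L-lipschitz_on A f) \<and> (\<exists>L. L-lipschitz_on B (inv_into A f))"
    using bij g(2) by blast
next
  assume r: "bij_betw f A B \<and> (\<exists>L. L-lipschitz_on A f) \<and> (\<exists>L. L-lipschitz_on B (inv_into A f))"
  then have bij: "bij_betw f A B" and cont: "continuous_on A f" "continuous_on B (inv_into A f)"
    by (auto intro: lipschitz_on_continuous_on)
  have "f ` A = B" "inv_into A f ` B = A"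
    using bij bij_betw_inv_into[OF bij] by (simp_all add: bij_betw_def)
  then have "homeomorphism A B f (inv_into A f)"
    using cont bij_betw_inv_into_left[OF bij] bij_betw_inv_into_right[OF bij]
    by (simp add: homeomorphism_def)
  then show "lipeomorphism A B f" using r by (auto simp: lipeomorphism_def)
qed

lemma increasing_lipeomorphism_iff:
  "increasing_lipeomorphism A B f \<longleftrightarrow>
     order_isomorphism A B f \<and> (\<exists>L. L-lipschitz_on A f) \<and> (\<exists>L. L-lipschitz_on B (inv_into A f))"
  unfolding increasing_lipeomorphism_def order_isomorphism_def lipeomorphism_iff_bij_lipschitz
  by blast

text \<open>
  Both endpoints of a gap lie in the same fiber, so on them the glued map agrees with the
  order isomorphism for which the gap ratio is bounded.
\<close>
lemma measure_projection_gap_multiple: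
  assumes "compact K" "is_gap K l r"
  shows "measure_projection K r = measure_projection K l"
    and "measure_projection K l \<in> multiple_values K"
proof -
  show eq: "measure_projection K r = measure_projection K l"
    using measure_projection_gap[OF assms(1), of l r] assms(2) by (auto simp: is_gap_def)
  show "measure_projection K l \<in> multiple_values K"
    unfolding multiple_values_def fiber_def
    using eq assms measure_projection_in_range[OF assms(1), of l] by (force simp: is_gap_def)
qed

text \<open>
  The map \<open>\<phi>\<close> itself serves as the order isomorphism on every fiber, and the Lipschitz
  constants of \<open>\<phi>\<close> and of its inverse bound the gap ratios from above and from below.
\<close>
lemma gap_compatible_of_increasing_lipeomorphism:
  assumes M: "compact M"
    and \<psi>: "order_isomorphism {0..measure lebesgue M} {0..measure lebesgue K} \<psi>"
    and \<phi>: "increasing_lipeomorphism M K \<phi>"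
    and proj: "\<And>x. x \<in> M \<Longrightarrow> measure_projection K (\<phi> x) = \<psi> (measure_projection M x)"
  shows "gap_compatible \<psi> K M"
proof -
  obtain L L' where iso: "order_isomorphism M K \<phi>" and L: "L-lipschitz_on M \<phi>"
    and L': "L'-lipschitz_on K (inv_into M \<phi>)"
    using \<phi> by (auto simp: increasing_lipeomorphism_iff)
  have bij: "bij_betw \<phi> M K" using iso by (simp add: order_isomorphism_def)
  have fib: "order_isomorphism (fiber M s) (fiber K (\<psi> s)) \<phi>" if "s \<in> {0..measure lebesgue M}" for s
    using order_isomorphism_restrict_fiber[OF M iso _ proj that] \<psi>
    by (simp add: order_isomorphism_def bij_betw_def)
  have "\<psi> ` multiple_values M = multiple_values K"
    using \<psi> fib by (intro multiple_values_image) (auto simp: order_isomorphism_def)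
  moreover have fib': "order_isomorphism (fiber M s) (fiber K (\<psi> s)) \<phi>"
    if "s \<in> multiple_values M" for s
    using fib that by (simp add: multiple_values_def)
  ultimately have "fiber_compatible \<psi> K M"
    by (auto simp: fiber_compatible_def)
  moreover define C where "C = max 1 (max L L')"
  have C: "1 \<le> C" "L \<le> C" "L' \<le> C" by (auto simp: C_def)
  have ratio: "inverse C \<le> q \<and> q \<le> C"
    if g: "is_gap M l r"
      and q: "q = measure lebesgue {\<phi> l<..<\<phi> r} / measure lebesgue {l<..<r}" for l r q
  proof -
    have lr: "l \<in> M" "r \<in> M" "l < r" using g by (auto simp: is_gap_def)
    have less: "\<phi> l < \<phi> r" using order_isomorphism_less_iff[OF iso lr(1,2)] lr by simp
    have "\<phi> r - \<phi> l \<le> L * (r - l)"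
      using lipschitz_onD[OF L lr(2,1)] lr less by (simp add: dist_real_def)
    also have "\<dots> \<le> C * (r - l)" using C lr by (intro mult_right_mono) auto
    finally have 1: "\<phi> r - \<phi> l \<le> C * (r - l)" .
    have "\<phi> l \<in> K" "\<phi> r \<in> K" using bij lr by (auto simp: bij_betw_def)
    then have "r - l \<le> L' * (\<phi> r - \<phi> l)"
      using lipschitz_onD[OF L', of "\<phi> r" "\<phi> l"] lr less
      by (simp add: dist_real_def bij_betw_inv_into_left[OF bij])
    also have "\<dots> \<le> C * (\<phi> r - \<phi> l)" using C less by (intro mult_right_mono) auto
    finally have 2: "r - l \<le> C * (\<phi> r - \<phi> l)" .
    show ?thesis
      using 1 2 lr less C(1) by (simp add: q field_simps)
  qed
  ultimately show ?thesis
    unfolding gap_compatible_def corresponding_gap_def Let_def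
    using fib' C(1) ratio by (auto intro!: exI[of _ "\<lambda>_. \<phi>"] exI[of _ C])
qed

lemma increasing_lipeomorphism_of_gap_compatible:
  assumes M: "compact M" "M \<noteq> {}" and K: "compact K" "K \<noteq> {}"
    and \<psi>: "increasing_lipeomorphism {0..measure lebesgue M} {0..measure lebesgue K} \<psi>"
    and gc: "gap_compatible \<psi> K M"
  obtains \<phi> where "increasing_lipeomorphism M K \<phi>"
    "\<And>x. x \<in> M \<Longrightarrow> measure_projection K (\<phi> x) = \<psi> (measure_projection M x)"
proof -
  let ?I = "{0..measure lebesgue M}" and ?J = "{0..measure lebesgue K}"
  obtain L L' where iso\<psi>: "order_isomorphism ?I ?J \<psi>" and L: "L-lipschitz_on ?I \<psi>"
    and L': "L'-lipschitz_on ?J (inv_into ?I \<psi>)"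
    using \<psi> by (auto simp: increasing_lipeomorphism_iff)
  have bij\<psi>: "bij_betw \<psi> ?I ?J" using iso\<psi> by (simp add: order_isomorphism_def)
  obtain h C where mv: "\<psi> ` multiple_values M = multiple_values K"
    and h: "\<And>s. s \<in> multiple_values M \<Longrightarrow> order_isomorphism (fiber M s) (fiber K (\<psi> s)) (h s)"
    and C: "1 \<le> C"
    and ratio: "\<And>l r. is_gap M l r \<Longrightarrow>
      inverse C \<le> measure lebesgue {h (measure_projection M l) l<..<h (measure_projection M l) r}
                   / measure lebesgue {l<..<r} \<and>
      measure lebesgue {h (measure_projection M l) l<..<h (measure_projection M l) r}
                   / measure lebesgue {l<..<r} \<le> C"
    using gc unfolding gap_compatible_def fiber_compatible_def corresponding_gap_def Let_def
    by (elim conjE exE) metis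
  obtain h' where h': "\<And>s. s \<in> ?I \<Longrightarrow> order_isomorphism (fiber M s) (fiber K (\<psi> s)) (h' s)"
    and hh': "\<And>s. s \<in> multiple_values M \<Longrightarrow> h' s = h s"
    using extend_fiber_isomorphisms[OF M K bij\<psi> mv h] by metis
  define \<phi> where "\<phi> = (\<lambda>x. h' (measure_projection M x) x)"
  have iso: "order_isomorphism M K \<phi>"
    and proj: "\<And>x. x \<in> M \<Longrightarrow> measure_projection K (\<phi> x) = \<psi> (measure_projection M x)"
    using order_isomorphism_glue[OF M(1) K(1) iso\<psi> h'] by (simp_all add: \<phi>_def)
  have bij: "bij_betw \<phi> M K" using iso by (simp add: order_isomorphism_def)
  have gap: "\<phi> r - \<phi> l \<le> C * (r - l)" "r - l \<le> C * (\<phi> r - \<phi> l)" if g: "is_gap M l r" for l r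
  proof -
    have lr: "l \<in> M" "r \<in> M" "l < r" using g by (auto simp: is_gap_def)
    have less: "\<phi> l < \<phi> r" using order_isomorphism_less_iff[OF iso lr(1,2)] lr by simp
    have "\<phi> l = h (measure_projection M l) l" "\<phi> r = h (measure_projection M l) r"
      using measure_projection_gap_multiple[OF M(1) g] hh' by (auto simp: \<phi>_def)
    then show "\<phi> r - \<phi> l \<le> C * (r - l)" "r - l \<le> C * (\<phi> r - \<phi> l)"
      using ratio[OF g] lr less C by (auto simp: field_simps)
  qed
  have lip: "(max L C)-lipschitz_on M \<phi>"
    using C by (intro lipschitz_of_projection_and_gap_bounds[OF M(1) K(1) iso L proj _ gap(1)]) auto
  have inv: "inv_into M \<phi> z \<in> M" "\<phi> (inv_into M \<phi> z) = z" if "z \<in> K" for z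
    using bij that by (auto simp: bij_betw_def inv_into_into f_inv_into_f)
  have "(max L' C)-lipschitz_on K (inv_into M \<phi>)"
  proof (rule lipschitz_of_projection_and_gap_bounds
      [OF K(1) M(1) order_isomorphism_inverse[OF iso] L'])
    show "measure_projection M (inv_into M \<phi> z) = inv_into ?I \<psi> (measure_projection K z)"
      if "z \<in> K" for z
      using proj[OF inv(1)[OF that]] inv(2)[OF that]
        bij_betw_inv_into_left[OF bij\<psi> measure_projection_in_range[OF M(1)]] by metis
    show "inv_into M \<phi> r - inv_into M \<phi> l \<le> C * (r - l)" if "is_gap K l r" for l r
    proof -
      have "l \<in> K" "r \<in> K" using that by (auto simp: is_gap_def)
      then show ?thesis
        using gap(2)[of "inv_into M \<phi> l" "inv_into M \<phi> r"] inv that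
          order_isomorphism_is_gap_iff[OF M(1) K(1) iso, of "inv_into M \<phi> l" "inv_into M \<phi> r"]
        by simp
    qed
  qed (use C in simp)
  then have "increasing_lipeomorphism M K \<phi>"
    using iso lip by (auto simp: increasing_lipeomorphism_iff)
  then show thesis using that proj by blast
qed

theorem theorem5p5:
  fixes K M :: "real set" and \<psi> :: "real \<Rightarrow> real"
  assumes "compact K" and "measure lebesgue K > 0"
    and "compact M" and "measure lebesgue M > 0"
    and "increasing_lipeomorphism {0..measure lebesgue M} {0..measure lebesgue K} \<psi>"
  shows "(\<exists>\<phi>. increasing_lipeomorphism M K \<phi> \<and>
            (\<forall>x\<in>M. measure_projection K (\<phi> x) = \<psi> (measure_projection M x)))
         \<longleftrightarrow> gap_compatible \<psi> K M"
proof
  show "gap_compatible \<psi> K M" if "\<exists>\<phi>. increasing_lipeomorphism M K \<phi> \<and>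
            (\<forall>x\<in>M. measure_projection K (\<phi> x) = \<psi> (measure_projection M x))"
    using that gap_compatible_of_increasing_lipeomorphism[OF assms(3)] assms(5)
    unfolding increasing_lipeomorphism_iff[of "{0.._}"] by blast
  have "M \<noteq> {}" "K \<noteq> {}" using assms(2,4) by auto
  then show "\<exists>\<phi>. increasing_lipeomorphism M K \<phi> \<and>
            (\<forall>x\<in>M. measure_projection K (\<phi> x) = \<psi> (measure_projection M x))"
    if "gap_compatible \<psi> K M"
    using increasing_lipeomorphism_of_gap_compatible[OF assms(3) _ assms(1) _ assms(5) that]
    by metis
qed

end
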